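(* Let $C>0$, let $k>1$ be an integer, and let $T=C/k$ (so $r=kT/C=1$). Then the online algorithm $\textsc{FlushAll}$ is $3$-competitive in the discrete $k$-wallet model $\mathcal{M}^{C,k}_T$: there is a constant $c$ depending only on the model parameters such that for every transaction sequence $\mathsf{Tx}$ with all values at most $T$, $V_{\mathrm{OPT}}(\mathsf{Tx}) \le 3\, V_{\textsc{FlushAll}}(\mathsf{Tx}) + c$.
   Context: Discrete $k$-wallet model $\mathcal{M}^{C,k}_T$: Time is divided into discrete slots $t=1,2,\dots$. A transaction sequence is $\mathsf{Tx}=(\mathsf{tx}_1,\dots,\mathsf{tx}_n)$, where $\mathsf{tx}_t\in[0,T]$ is the value of the transaction arriving at slot $t$ (value $0$ means no transaction). A total collateral $C$ is divided into $k$ wallets, each of capacity $C/k$. Each wallet is either online with some available (uncommitted) collateral $R\in[0,C/k]$, or offline. When a transaction of value $v$ arrives, the policy must immediately either settle it, using an online wallet with $R\ge v$ (whose available collateral becomes $R-v$), or discard it. At any time $t$ the policy may flush a wallet; the wallet is then offline during the slots of the interval $(t,t+F]$ (with $F$ a fixed positive integer flush period), after which it is online again with available collateral reset to $C/k$. For a policy $\mathrm{A}$, $V_{\mathrm{A}}(\mathsf{Tx})$ denotes the total value of transactions it settles. An algorithm is online if its decisions at time $N$ depend only on $\mathsf{tx}_1,\dots,\mathsf{tx}_N$. $\mathrm{OPT}$ denotes an optimal offline $k$-wallet policy, i.e. $V_{\mathrm{OPT}}(\mathsf{Tx})$ is the maximum settled value achievable by any $k$-wallet policy with full knowledge of $\mathsf{Tx}$.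 An algorithm $\mathrm{A}$ is $\alpha$-competitive in this model if for every sequence $\mathsf{Tx}$ with values at most $T$, $V_{\mathrm{OPT}}(\mathsf{Tx})\le \alpha V_{\mathrm{A}}(\mathsf{Tx})+O(1)$, where the $O(1)$ constant may depend on $C,k,T$ (and $F$) but not on $\mathsf{Tx}$ or its length. Algorithm $\textsc{FlushAll}$: the wallets are placed in a fixed order $W_1,\dots,W_k$. Each arriving transaction is settled by the first wallet in this order that has enough available collateral to fit it (first fit). When a transaction arrives that fits in no wallet, it is discarded and all $k$ wallets are flushed simultaneously (so all transactions arriving during the following flush period are discarded); afterwards the process repeats. *)

theory Defs
  imports Complex_Main
begin

text \<open>\<^term>\<open>Offline m\<close>: the wallet is offline in the current slot and in the \<open>m - 1\<close> slots after it.\<close>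

datatype wallet = is_online: Online real | Offline nat

text \<open>
  What a policy does in one slot: the wallet settling the arriving transaction (\<^term>\<open>None\<close>: the
  transaction is discarded), and the set of wallets flushed. The wallets \<open>W\<^sub>1, \<dots>, W\<^sub>k\<close> have the
  list indices \<open>0, \<dots>, k - 1\<close>.
\<close>

datatype decision = Decision (settled_by: "nat option") (flushed: "nat set")

definition fits :: "real \<Rightarrow> wallet \<Rightarrow> bool" where
  "fits v w \<longleftrightarrow> (\<exists>R. w = Online R \<and> v \<le> R)"

definition admissible :: "real \<Rightarrow> wallet list \<Rightarrow> decision \<Rightarrow> bool" where
  "admissible v W d \<longleftrightarrow>
     (\<forall>i. settled_by d = Some i \<longrightarrow> i < length W \<and> fits v (W ! i)) \<and>
     flushed d \<subseteq> {..<length W}"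

fun commit :: "real \<Rightarrow> wallet \<Rightarrow> wallet" where
  "commit v (Online R) = Online (R - v)"
| "commit v (Offline m) = Offline m"

fun tick :: "real \<Rightarrow> wallet \<Rightarrow> wallet" where
  "tick cap (Online R) = Online R"
| "tick cap (Offline m) = (if m \<le> 1 then Online cap else Offline (m - 1))"

text \<open>
  Transition from the state in slot \<open>t\<close> to the state in slot \<open>t + 1\<close>, for wallets of capacity
  \<open>cap\<close>. A wallet flushed at time \<open>t\<close> is offline only from slot \<open>t + 1\<close> on (the interval
  \<open>(t, t + F]\<close>), so it may still settle the transaction of slot \<open>t\<close>. Flushing a wallet that is
  already offline restarts its flush period.
\<close>

definition step :: "real \<Rightarrow> nat \<Rightarrow> real \<Rightarrow> decision \<Rightarrow> wallet list \<Rightarrow> wallet list" where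
  "step cap F v d W =
     map (\<lambda>i. if i \<in> flushed d then Offline F
              else tick cap (if settled_by d = Some i then commit v (W ! i) else W ! i))
         [0..<length W]"

definition init :: "real \<Rightarrow> nat \<Rightarrow> wallet list" where
  "init C k = replicate k (Online (C / real k))"

fun feasible_from :: "real \<Rightarrow> nat \<Rightarrow> wallet list \<Rightarrow> real list \<Rightarrow> decision list \<Rightarrow> bool" where
  "feasible_from cap F W [] [] = True"
| "feasible_from cap F W (v # vs) (d # ds) =
     (admissible v W d \<and> feasible_from cap F (step cap F v d W) vs ds)"
| "feasible_from cap F W _ _ = False"

definition feasible :: "real \<Rightarrow> nat \<Rightarrow> nat \<Rightarrow> real list \<Rightarrow> decision list \<Rightarrow> bool" where
  "feasible C k F Tx ds \<longleftrightarrow> feasible_from (C / real k) F (init C k) Tx ds"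

definition settled_value :: "real list \<Rightarrow> decision list \<Rightarrow> real" where
  "settled_value Tx ds = (\<Sum>(v, d) \<leftarrow> zip Tx ds. if settled_by d = None then 0 else v)"

definition V_OPT :: "real \<Rightarrow> nat \<Rightarrow> nat \<Rightarrow> real list \<Rightarrow> real" where
  "V_OPT C k F Tx = Max {settled_value Tx ds | ds. feasible C k F Tx ds}"

text \<open>An online algorithm maps the prefix \<open>tx\<^sub>1, \<dots>, tx\<^sub>N\<close> to its decision at time \<open>N\<close>.\<close>

type_synonym online_alg = "real list \<Rightarrow> decision"

definition decisions :: "online_alg \<Rightarrow> real list \<Rightarrow> decision list" where
  "decisions A Tx = map (\<lambda>N. A (take N Tx)) [1..<Suc (length Tx)]"

definition V_alg :: "online_alg \<Rightarrow> real list \<Rightarrow> real" where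
  "V_alg A Tx = settled_value Tx (decisions A Tx)"

definition tx_seqs :: "real \<Rightarrow> real list set" where
  "tx_seqs T = {Tx. set Tx \<subseteq> {0..T}}"

definition k_wallet_alg :: "real \<Rightarrow> nat \<Rightarrow> real \<Rightarrow> nat \<Rightarrow> online_alg \<Rightarrow> bool" where
  "k_wallet_alg C k T F A \<longleftrightarrow> (\<forall>Tx \<in> tx_seqs T. feasible C k F Tx (decisions A Tx))"

definition competitive :: "real \<Rightarrow> nat \<Rightarrow> real \<Rightarrow> nat \<Rightarrow> real \<Rightarrow> online_alg \<Rightarrow> bool" where
  "competitive C k T F \<alpha> A \<longleftrightarrow>
     k_wallet_alg C k T F A \<and>
     (\<exists>c. \<forall>Tx \<in> tx_seqs T. V_OPT C k F Tx \<le> \<alpha> * V_alg A Tx + c)"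

text \<open>
  Under this rule the wallets are always all online or all offline; in the latter case the arriving
  transaction is discarded without flushing again.
\<close>

definition flush_all_rule :: "real \<Rightarrow> wallet list \<Rightarrow> decision" where
  "flush_all_rule v W =
     (case find (\<lambda>i. fits v (W ! i)) [0..<length W] of
        Some i \<Rightarrow> Decision (Some i) {}
      | None \<Rightarrow> Decision None (if \<forall>w \<in> set W. is_online w then {..<length W} else {}))"

definition flush_all_state :: "real \<Rightarrow> nat \<Rightarrow> nat \<Rightarrow> real list \<Rightarrow> wallet list" where
  "flush_all_state C k F Tx =
     foldl (\<lambda>W v. step (C / real k) F v (flush_all_rule v W) W) (init C k) Tx"

definition flush_all :: "real \<Rightarrow> nat \<Rightarrow> nat \<Rightarrow> online_alg" where
  "flush_all C k F Tx = flush_all_rule (last Tx) (flush_all_state C k F (butlast Tx))"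

text \<open>The maximum defining \<^const>\<open>V_OPT\<close> is over a finite nonempty set, hence attained.\<close>

lemma finite_settled_values: "finite {settled_value Tx ds | ds. P ds}"
proof -
  have "settled_value Tx ds \<in> (\<lambda>bs. \<Sum>(v, b) \<leftarrow> zip Tx bs. if b then 0 else v) `
          {bs. set bs \<subseteq> UNIV \<and> length bs \<le> length Tx}" for ds
  proof -
    have "settled_value Tx ds =
        (\<Sum>(v, b) \<leftarrow> zip Tx (map (\<lambda>d. settled_by d = None) (take (length Tx) ds)). if b then 0 else v)"
      unfolding settled_value_def
      by (induction Tx ds rule: list_induct2') auto
    thus ?thesis
      by (intro image_eqI[where x = "map (\<lambda>d. settled_by d = None) (take (length Tx) ds)"]) auto
  qed
  moreover have "finite {bs. set bs \<subseteq> (UNIV :: bool set) \<and> length bs \<le> length Tx}"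
    by (intro finite_lists_length_le) simp
  ultimately show ?thesis
    by (elim finite_subset[OF _ finite_imageI, rotated]) blast
qed

lemma feasible_from_discard:
  "feasible_from cap F W Tx (replicate (length Tx) (Decision None {}))"
  by (induction Tx arbitrary: W) (auto simp: admissible_def)

lemma V_OPT_attained: "\<exists>ds. feasible C k F Tx ds \<and> V_OPT C k F Tx = settled_value Tx ds"
proof -
  have "{settled_value Tx ds | ds. feasible C k F Tx ds} \<noteq> {}"
    using feasible_from_discard unfolding feasible_def by blast
  from Max_in[OF finite_settled_values this] show ?thesis
    unfolding V_OPT_def by auto
qed

end

theory Submission
  imports Defs
begin

text \<open>
  Write \<open>cap = C / k\<close>. While the wallets of FlushAll are online, the optimum gains at most what
  FlushAll gains. From the rejection of a transaction until the wallets are back online, \<open>F + 1\<close>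
  slots pass; a wallet flushed in this window does not return within it, so the optimum settles at
  most \<open>cap\<close> per wallet, \<open>C\<close> in total. When FlushAll rejects a transaction, every wallet is in use,
  and by first fit any two wallets together hold more than \<open>cap\<close>; hence FlushAll has settled at least
  \<open>C / 2\<close> in the phase, and the window costs at most twice that. The last, incomplete phase is
  absorbed by the additive constant \<open>C\<close>.
\<close>

section \<open>FlushAll as a recursive run\<close>

fun flush_all_run :: "real \<Rightarrow> nat \<Rightarrow> wallet list \<Rightarrow> real list \<Rightarrow> decision list" where
  "flush_all_run cap F W [] = []"
| "flush_all_run cap F W (v # vs) =
     flush_all_rule v W # flush_all_run cap F (step cap F v (flush_all_rule v W) W) vs"

lemma flush_all_run_append:
  "flush_all_run cap F W (vs @ [v]) =
     flush_all_run cap F W vs @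
     [flush_all_rule v (foldl (\<lambda>W v. step cap F v (flush_all_rule v W) W) W vs)]"
  by (induction vs arbitrary: W) auto

lemma decisions_append: "decisions A (vs @ [v]) = decisions A vs @ [A (vs @ [v])]"
  by (auto simp: decisions_def)

text \<open>\<open>decisions\<close> recomputes the state from every prefix, while the run threads
  it from any starting wallets, as the induction in \<open>flush_all_potential\<close> needs.
  Prefixes grow at the end, hence the reverse induction.\<close>

lemma decisions_flush_all:
  "decisions (flush_all C k F) Tx = flush_all_run (C / real k) F (init C k) Tx"
proof (induction Tx rule: rev_induct)
  case Nil
  show ?case by (simp add: decisions_def)
next
  case (snoc v vs)
  then show ?case
    by (simp add: decisions_append flush_all_run_append flush_all_def flush_all_state_def)
qed

lemma flush_all_rule_cases:
  obtains (settle) i where "i < length W" "fits v (W ! i)" "\<And>j. j < i \<Longrightarrow> \<not> fits v (W ! j)"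
      "flush_all_rule v W = Decision (Some i) {}"
  | (reject) "\<And>j. j < length W \<Longrightarrow> \<not> fits v (W ! j)"
      "flush_all_rule v W = Decision None (if \<forall>w \<in> set W. is_online w then {..<length W} else {})"
proof (cases "find (\<lambda>i. fits v (W ! i)) [0..<length W]")
  case None
  then have "\<And>j. j < length W \<Longrightarrow> \<not> fits v (W ! j)"
    by (simp add: find_None_iff)
  then show ?thesis
    by (rule reject) (auto simp: flush_all_rule_def None)
next
  case (Some i)
  then have "i < length W" "fits v (W ! i)" "\<And>j. j < i \<Longrightarrow> \<not> fits v (W ! j)"
    by (auto simp: find_Some_iff)
  moreover have "flush_all_rule v W = Decision (Some i) {}"
    by (simp add: flush_all_rule_def Some)
  ultimately show ?thesis
    by (rule settle)
qed

lemma admissible_flush_all_rule: "admissible v W (flush_all_rule v W)"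
  by (cases v W rule: flush_all_rule_cases) (auto simp: admissible_def)

lemma feasible_flush_all_run: "feasible_from cap F W Tx (flush_all_run cap F W Tx)"
  by (induction Tx arbitrary: W) (auto simp: admissible_flush_all_rule)

section \<open>Windows for an arbitrary policy\<close>

lemma length_step [simp]: "length (step cap F v d W) = length W"
  by (simp add: step_def)

lemma nth_step:
  "i < length W \<Longrightarrow> step cap F v d W ! i =
     (if i \<in> flushed d then Offline F
      else tick cap (if settled_by d = Some i then commit v (W ! i) else W ! i))"
  by (simp add: step_def)

definition decision_value :: "real \<Rightarrow> decision \<Rightarrow> real" where
  "decision_value v d = (if settled_by d = None then 0 else v)"

lemma settled_value_Nil [simp]: "settled_value [] ds = 0"
  by (simp add: settled_value_def)

lemma settled_value_Cons [simp]:
  "settled_value (v # vs) (d # ds) = decision_value v d + settled_value vs ds"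
  by (simp add: settled_value_def decision_value_def)

lemma decision_value_le: "0 \<le> v \<Longrightarrow> decision_value v d \<le> v"
  by (simp add: decision_value_def)

definition wallet_ok :: "real \<Rightarrow> wallet \<Rightarrow> bool" where
  "wallet_ok cap w \<longleftrightarrow> (\<forall>R. w = Online R \<longrightarrow> 0 \<le> R \<and> R \<le> cap)"

lemma wallet_ok_step:
  assumes "0 \<le> cap" "0 \<le> v" "\<forall>w \<in> set W. wallet_ok cap w" "admissible v W d"
  shows "\<forall>w \<in> set (step cap F v d W). wallet_ok cap w"
proof -
  have "wallet_ok cap (step cap F v d W ! i)" if "i < length W" for i
  proof -
    have ok: "wallet_ok cap (W ! i)" and fit: "settled_by d = Some i \<Longrightarrow> fits v (W ! i)"
      using assms(3,4) that by (auto simp: admissible_def)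
    show ?thesis
      using ok fit assms(1,2) that
      by (cases "W ! i") (auto simp: nth_step wallet_ok_def fits_def)
  qed
  then show ?thesis
    by (auto simp: in_set_conv_nth)
qed

text \<open>The value a wallet can settle within the next \<open>n\<close> slots, provided \<open>n \<le> F + 1\<close>.\<close>

definition window_value :: "real \<Rightarrow> nat \<Rightarrow> wallet \<Rightarrow> real" where
  "window_value cap n w =
     (if n = 0 then 0 else case w of Online R \<Rightarrow> R | Offline m \<Rightarrow> if m < n then cap else 0)"

lemma window_value_le: "0 \<le> cap \<Longrightarrow> wallet_ok cap w \<Longrightarrow> window_value cap n w \<le> cap"
  by (auto simp: window_value_def wallet_ok_def split: wallet.splits)

lemma sum_window_value_le:
  assumes "0 \<le> cap" "\<forall>w \<in> set W. wallet_ok cap w"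
  shows "(\<Sum>i<length W. window_value cap n (W ! i)) \<le> real (length W) * cap"
  using sum_bounded_above[of "{..<length W}" "\<lambda>i. window_value cap n (W ! i)" cap]
  by (simp add: window_value_le assms)

text \<open>Settling \<open>v\<close> uses up \<open>v\<close> of an online wallet's collateral; a
  wallet flushed now is worth 0 afterwards because \<open>n \<le> F\<close>; for a wallet that stays
  offline, the waiting time and the window shrink together.\<close>

lemma window_value_step:
  assumes "0 \<le> cap" "\<forall>w \<in> set W. wallet_ok cap w" "admissible v W d" "n \<le> F"
  shows "decision_value v d + (\<Sum>i<length W. window_value cap n (step cap F v d W ! i))
           \<le> (\<Sum>i<length W. window_value cap (Suc n) (W ! i))"
proof -
  \<comment> \<open>The gain of the slot is spread over the wallets, so that the inequality can be
    checked wallet by wallet.\<close>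
  have dv: "decision_value v d = (\<Sum>i<length W. if settled_by d = Some i then v else 0)"
  proof (cases "settled_by d")
    case None
    then show ?thesis by (simp add: decision_value_def)
  next
    case (Some j)
    then have "j < length W"
      using assms(3) by (simp add: admissible_def)
    with Some show ?thesis by (simp add: decision_value_def)
  qed
  have "(if settled_by d = Some i then v else 0) + window_value cap n (step cap F v d W ! i)
          \<le> window_value cap (Suc n) (W ! i)" if "i < length W" for i
  proof -
    have ok: "wallet_ok cap (W ! i)" and fit: "settled_by d = Some i \<Longrightarrow> fits v (W ! i)"
      using assms(2,3) that by (auto simp: admissible_def)
    show ?thesis
      using ok fit assms(1,4) that
      by (cases "W ! i") (auto simp: nth_step wallet_ok_def fits_def window_value_def)
  qed
  then show ?thesis
    unfolding dv sum.distrib[symmetric] by (intro sum_mono) auto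
qed

section \<open>Residuals under first fit\<close>

text \<open>
  The residual collaterals left by first fit: a wallet is only used for a transaction that fits
  into no earlier wallet.
\<close>

definition first_fit_residuals :: "real \<Rightarrow> real list \<Rightarrow> bool" where
  "first_fit_residuals cap Rs \<longleftrightarrow>
     (\<forall>R \<in> set Rs. 0 \<le> R \<and> R \<le> cap) \<and>
     (\<forall>j < length Rs. \<forall>i < j. Rs ! j < cap \<longrightarrow> Rs ! i + Rs ! j < cap)"

lemma first_fit_residuals_replicate: "0 \<le> cap \<Longrightarrow> first_fit_residuals cap (replicate k cap)"
  by (auto simp: first_fit_residuals_def)

text \<open>If the used wallet is the later of a pair, the earlier residual is below
  \<open>v\<close>, so the new sum is below the old \<open>Rs ! i\<close>, which is at most
  \<open>cap\<close>. In any other pair the later wallet is unchanged and the sum does not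
  grow.\<close>

lemma first_fit_residuals_update:
  assumes "first_fit_residuals cap Rs" "0 \<le> v" "i < length Rs" "v \<le> Rs ! i"
    and "\<And>j. j < i \<Longrightarrow> Rs ! j < v"
  shows "first_fit_residuals cap (Rs[i := Rs ! i - v])"
proof -
  have range: "0 \<le> Rs ! j \<and> Rs ! j \<le> cap" if "j < length Rs" for j
    using assms(1) that by (auto simp: first_fit_residuals_def)
  have pair: "Rs ! a + Rs ! b < cap" if "a < b" "b < length Rs" "Rs ! b < cap" for a b
    using assms(1) that by (auto simp: first_fit_residuals_def)
  let ?Rs = "Rs[i := Rs ! i - v]"
  have "0 \<le> R \<and> R \<le> cap" if R: "R \<in> set ?Rs" for R
  proof -
    obtain j where "j < length Rs" "R = ?Rs ! j"
      using R by (auto simp: in_set_conv_nth)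
    then show ?thesis
      using range[of j] assms(2-4) by (cases "j = i") auto
  qed
  moreover have "?Rs ! a + ?Rs ! b < cap"
    if ab: "a < b" "b < length Rs" "?Rs ! b < cap" for a b
  proof (cases "b = i")
    case True
    then show ?thesis
      using assms(5)[of a] range[of i] assms(3) ab(1) by simp
  next
    case False
    then show ?thesis
      using pair[of a b] ab assms(2,3) by (cases "a = i") auto
  qed
  ultimately show ?thesis
    by (auto simp: first_fit_residuals_def)
qed

lemma first_fit_residuals_half:
  assumes "first_fit_residuals cap Rs" "1 < length Rs" "\<And>i. i < length Rs \<Longrightarrow> Rs ! i < cap"
  shows "2 * (\<Sum>i<length Rs. Rs ! i) \<le> real (length Rs) * cap"
proof -
  have pair: "Rs ! a + Rs ! b \<le> cap" if "a < b" "b < length Rs" for a b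
    using assms(1,3) that by (fastforce simp: first_fit_residuals_def)
  obtain n where n: "length Rs = Suc n" "0 < n"
    using assms(2) by (cases "length Rs") auto
  have "2 * (\<Sum>i<length Rs. Rs ! i) =
      (\<Sum>i<Suc n. Rs ! i) + (\<Sum>i<Suc n. Rs ! i)"
    by (simp add: n)
  \<comment> \<open>One copy gives up its first term, the other its last: the doubled sum runs over
    neighbours on the cycle 0, ..., n, 0. Since \<open>0 < n\<close>, each pair consists of two
    distinct wallets.\<close>
  also have "\<dots> = (Rs ! 0 + Rs ! n) + (\<Sum>i<n. Rs ! i + Rs ! Suc i)"
    by (subst sum.lessThan_Suc_shift) (simp add: sum.distrib)
  also have "\<dots> \<le> cap + (\<Sum>i<n. cap)"
    using n by (intro add_mono sum_mono pair) auto
  finally show ?thesis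
    by (simp add: n algebra_simps)
qed

section \<open>The potential argument\<close>

lemma step_settle_online:
  assumes "i < length Rs"
  shows "step cap F v (Decision (Some i) {}) (map Online Rs) = map Online (Rs[i := Rs ! i - v])"
  using assms by (intro nth_equalityI) (auto simp: nth_step nth_list_update)

lemma step_flush_all:
  "step cap F v (Decision None {..<length W}) W = replicate (length W) (Offline F)"
  by (intro nth_equalityI) (auto simp: nth_step)

lemma step_idle_offline:
  "step cap F v (Decision None {}) (replicate k (Offline m)) =
     replicate k (if m \<le> 1 then Online cap else Offline (m - 1))"
  by (intro nth_equalityI) (auto simp: nth_step)

text \<open>
  The term \<open>2 * (\<Sum>i<k. cap - Rs ! i)\<close> is the credit accumulated by FlushAll in the current phase;
  it pays for the window during which FlushAll is offline.
\<close>

lemma flush_all_potential: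
  assumes "0 < cap" "1 < k" "0 < F" "set Tx \<subseteq> {0..cap}"
    and "length W = k" "\<forall>w \<in> set W. wallet_ok cap w" "feasible_from cap F W Tx ds"
  shows "(length Rs = k \<longrightarrow> first_fit_residuals cap Rs \<longrightarrow>
            settled_value Tx ds \<le> 3 * settled_value Tx (flush_all_run cap F (map Online Rs) Tx)
              + 2 * (\<Sum>i<k. cap - Rs ! i) + real k * cap) \<and>
         (0 < m \<longrightarrow> m \<le> F \<longrightarrow>
            settled_value Tx ds
              \<le> 3 * settled_value Tx (flush_all_run cap F (replicate k (Offline m)) Tx)
              + (\<Sum>i<k. window_value cap m (W ! i)) + real k * cap)"
  using assms(4-7)
proof (induction Tx arbitrary: W ds Rs m)
  case Nil
  have "0 \<le> (\<Sum>i<k. cap - Rs ! i)" if "length Rs = k" "first_fit_residuals cap Rs"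
    using that by (intro sum_nonneg) (auto simp: first_fit_residuals_def)
  moreover have "0 \<le> window_value cap m w" if "wallet_ok cap w" for w
    using that assms(1) by (auto simp: window_value_def wallet_ok_def split: wallet.splits)
  then have "0 \<le> (\<Sum>i<k. window_value cap m (W ! i))"
    using Nil by (intro sum_nonneg) auto
  ultimately show ?case
    using assms(1,2) by auto
next
  case (Cons v vs)
  obtain d ds' where ds: "ds = d # ds'"
    using Cons.prems(4) by (cases ds) auto
  let ?W = "step cap F v d W"
  have v: "0 \<le> v" "v \<le> cap" and vs: "set vs \<subseteq> {0..cap}"
    using Cons.prems(1) by auto
  have adm: "admissible v W d" and feas: "feasible_from cap F ?W vs ds'"
    using Cons.prems(4) by (auto simp: ds)
  have ok: "\<forall>w \<in> set ?W. wallet_ok cap w"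
    using wallet_ok_step[OF _ v(1) Cons.prems(3) adm] assms(1) by simp
  have lenW: "length ?W = k"
    using Cons.prems(2) by simp
  note IH_online = mp[OF mp[OF conjunct1[OF Cons.IH[OF vs lenW ok feas]]]]
  note IH_offline = mp[OF mp[OF conjunct2[OF Cons.IH[OF vs lenW ok feas]]]]
  have window: "decision_value v d + (\<Sum>i<k. window_value cap n (?W ! i))
      \<le> (\<Sum>i<k. window_value cap (Suc n) (W ! i))" if "n \<le> F" for n
    using window_value_step[OF _ Cons.prems(3) adm that] assms(1) Cons.prems(2) by simp
  have "settled_value (v # vs) ds
      \<le> 3 * settled_value (v # vs) (flush_all_run cap F (map Online Rs) (v # vs))
        + 2 * (\<Sum>i<k. cap - Rs ! i) + real k * cap"
    if Rs: "length Rs = k" "first_fit_residuals cap Rs"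
  proof (cases v "map Online Rs" rule: flush_all_rule_cases)
    case (settle i)
    have i: "i < length Rs" "v \<le> Rs ! i"
      using settle by (auto simp: fits_def)
    have "Rs ! j < v" if "j < i" for j
      using settle(3)[OF that] i(1) that by (auto simp: fits_def)
    then have inv: "first_fit_residuals cap (Rs[i := Rs ! i - v])"
      using first_fit_residuals_update[OF Rs(2) v(1) i] by blast
    have "(\<Sum>j<k. cap - Rs[i := Rs ! i - v] ! j) =
        (\<Sum>j<k. (cap - Rs ! j) + (if j = i then v else 0))"
      using Rs(1) by (intro sum.cong) (auto simp: nth_list_update)
    also have "\<dots> = (\<Sum>j<k. cap - Rs ! j) + v"
      using i(1) Rs(1) by (simp only: sum.distrib) simp
    finally have credit: "(\<Sum>j<k. cap - Rs[i := Rs ! i - v] ! j) = (\<Sum>j<k. cap - Rs ! j) + v" .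
    \<comment> \<open>Of the \<open>3 * v\<close> gained on the right, one \<open>v\<close> covers
      the other policy's gain in this slot and \<open>2 * v\<close> pays for the growth of the
      credit.\<close>
    show ?thesis
      using IH_online[OF _ inv] Rs(1) decision_value_le[OF v(1), of d]
      by (simp add: ds settle(4) step_settle_online[OF i(1)] credit decision_value_def[of v "Decision _ _"])
  next
    case reject
    have rule: "flush_all_rule v (map Online Rs) = Decision None {..<length (map Online Rs)}"
      using reject(2) by simp
    \<comment> \<open>No wallet is full, since the rejected \<open>v\<close> is at most
      \<open>cap\<close>.\<close>
    have "Rs ! i < cap" if "i < length Rs" for i
      using reject(1)[of i] that v(2) by (auto simp: fits_def)
    then have "2 * (\<Sum>i<length Rs. Rs ! i) \<le> real (length Rs) * cap"
      using Rs assms(2) by (intro first_fit_residuals_half) auto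
    then have credit: "real k * cap \<le> 2 * (\<Sum>i<k. cap - Rs ! i)"
      using Rs(1) by (simp add: sum_subtractf algebra_simps)
    \<comment> \<open>The rejecting slot itself counts: the window has \<open>Suc F\<close> slots,
      this one and the \<open>F\<close> offline ones.\<close>
    have "decision_value v d + (\<Sum>i<k. window_value cap F (?W ! i)) \<le> real k * cap"
      using window[of F] sum_window_value_le[OF _ Cons.prems(3), of "Suc F"] assms(1) Cons.prems(2)
      by simp
    then show ?thesis
      using IH_offline[of F] assms(3) credit Rs(1)
      unfolding ds flush_all_run.simps rule step_flush_all settled_value_Cons
      by (simp add: decision_value_def[of v "Decision _ _"])
  qed
  moreover have "settled_value (v # vs) ds
      \<le> 3 * settled_value (v # vs) (flush_all_run cap F (replicate k (Offline m)) (v # vs))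
        + (\<Sum>i<k. window_value cap m (W ! i)) + real k * cap"
    if m: "0 < m" "m \<le> F"
  proof -
    \<comment> \<open>As \<open>k > 0\<close>, some wallet is offline, so the rule does not flush
      again.\<close>
    have rule: "flush_all_rule v (replicate k (Offline m)) = Decision None {}"
      using assms(2) by (cases v "replicate k (Offline m)" rule: flush_all_rule_cases)
        (auto simp: fits_def)
    obtain n where n: "m = Suc n"
      using m(1) by (cases m) auto
    have w: "decision_value v d + (\<Sum>i<k. window_value cap n (?W ! i))
        \<le> (\<Sum>i<k. window_value cap m (W ! i))"
      using window[of n] m n by simp
    show ?thesis
    \<comment> \<open>For \<open>n = 0\<close> this is the last offline slot: all wallets return
      full, and the online half of the induction hypothesis applies with credit 0.\<close>
    proof (cases "n = 0")
      case True
      have "first_fit_residuals cap (replicate k cap)"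
        using assms(1) by (simp add: first_fit_residuals_replicate)
      from IH_online[OF _ this] w True n rule show ?thesis
        by (simp add: ds step_idle_offline decision_value_def[of v "Decision _ _"] window_value_def[of cap 0])
    next
      case False
      then show ?thesis
        using IH_offline[of n] w m n rule
        by (simp add: ds step_idle_offline decision_value_def[of v "Decision _ _"])
    qed
  qed
  ultimately show ?case by blast
qed

theorem theorem4:
  fixes C T :: real and k F :: nat
  assumes "C > 0" and "k > 1" and "F > 0" and "T = C / real k"
  shows "competitive C k T F 3 (flush_all C k F)"
proof -
  have cap: "0 < C / real k"
    using assms(1,2) by simp
  have "V_OPT C k F Tx \<le> 3 * V_alg (flush_all C k F) Tx + C" if Tx: "Tx \<in> tx_seqs T" for Tx
  proof -
    obtain ds where ds: "feasible C k F Tx ds" "V_OPT C k F Tx = settled_value Tx ds"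
      using V_OPT_attained by blast
    have "set Tx \<subseteq> {0..C / real k}"
      using Tx assms(4) by (simp add: tx_seqs_def)
    moreover have "\<forall>w \<in> set (init C k). wallet_ok (C / real k) w"
      using cap by (auto simp: init_def wallet_ok_def)
    \<comment> \<open>FlushAll starts with full wallets, so the credit is 0, and the remaining
      constant equals \<open>C\<close>.\<close>
    ultimately have "settled_value Tx ds
        \<le> 3 * settled_value Tx (flush_all_run (C / real k) F (map Online (replicate k (C / real k))) Tx)
          + 2 * (\<Sum>i<k. C / real k - replicate k (C / real k) ! i) + real k * (C / real k)"
      using flush_all_potential[OF cap assms(2,3), of Tx "init C k" ds "replicate k (C / real k)"]
        ds(1) cap by (simp add: feasible_def init_def first_fit_residuals_replicate)
    then show ?thesis
      using ds(2) assms(2) by (simp add: V_alg_def decisions_flush_all init_def)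
  qed
  moreover have "k_wallet_alg C k T F (flush_all C k F)"
    by (simp add: k_wallet_alg_def decisions_flush_all feasible_def feasible_flush_all_run)
  ultimately show ?thesis
    unfolding competitive_def by blast
qed

end
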